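(* Let $m\ge2$ and let $\mathbf K^*_m(v)=|\mathbf K_m(v)|\,\mathbf K_m(v)^{-1}$ be the adjugate of $\mathbf K_m(v)$, that is, the transpose of its matrix of cofactors. Then none of the entries of the last row of $\mathbf K^*_m(v)$ is identically zero.
   Context: For $m\ge1$, $\mathbf K_m(v)$ is the $m\times m$ matrix with entries in $\mathbb{Q}(x,v)$ defined as follows. - All diagonal entries equal $1-xv$, except the $(m,m)$ entry, which equals $1-xv+\frac{xv}{1-v}$. - All entries strictly above the diagonal equal $-xv$. - The entries at positions $(i+1,i)$ equal $\frac{xv}{1-v}$. - All other entries are $0$. $|\cdot|$ denotes the determinant. *)

theory Defs
  imports
    "HOL-Computational_Algebra.Fraction_Field"
    "Jordan_Normal_Form.Determinant"
begin

(* Q(x,v) is realised as the fraction field of Q[x][v]: the inner polynomial variable is x,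
   the outer one is v. *)
type_synonym ratfun = "rat poly poly fract"

definition X :: ratfun where
  "X = Fract [:[:0, 1:]:] 1"

definition V :: ratfun where
  "V = Fract [:0, 1:] 1"

(* Matrix indices start at 0, so the bottom right diagonal entry is the one with i = j and Suc i = m. *)
definition K_mat :: "nat \<Rightarrow> ratfun \<Rightarrow> ratfun mat" where
  "K_mat m v = mat m m (\<lambda>(i, j).
     if i = j then (if Suc i = m then 1 - X * v + X * v / (1 - v) else 1 - X * v)
     else if i < j then - (X * v)
     else if i = Suc j then X * v / (1 - v)
     else 0)"

end

theory Submission
  imports Defs
begin

text \<open>
  Deleting row \<open>j\<close> and the last column of an upper Hessenberg matrix leaves a block upper
  triangular matrix: its first diagonal block is the leading \<open>j \<times> j\<close> block and its second one is
  upper triangular with subdiagonal entries of the original matrix on the diagonal. For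
  \<open>K\<^sub>m(v)\<close> these subdiagonal entries are the nonzero \<open>xv/(1-v)\<close>, while the leading block
  specialises to the identity matrix at \<open>v = 0\<close>, so its determinant is nonzero too.
\<close>

lemma det_mat_delete_last_col_hessenberg:
  fixes A :: "'a :: idom mat"
  assumes A: "A \<in> carrier_mat (Suc n) (Suc n)" and j: "j \<le> n"
    and hess: "\<And>i k. i < Suc n \<Longrightarrow> Suc k < i \<Longrightarrow> A $$ (i, k) = 0"
  shows "det (mat_delete A j n) =
    det (mat j j (\<lambda>p. A $$ p)) * (\<Prod>i = j..<n. A $$ (Suc i, i))"
proof -
  define B where "B = mat j j (\<lambda>p. A $$ p)"
  define C where "C = mat j (n - j) (\<lambda>(i, k). A $$ (i, k + j))"
  \<comment> \<open>Row \<open>j\<close> is skipped, so the diagonal of \<open>D\<close> runs along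
    the subdiagonal of \<open>A\<close>, and entries below it lie at least two below the diagonal of
    \<open>A\<close>.\<close>
  define D where "D = mat (n - j) (n - j) (\<lambda>(i, k). A $$ (Suc (i + j), k + j))"
  have blocks: "mat_delete A j n = four_block_mat B C (0\<^sub>m (n - j) j) D"
    using A j
    by (intro eq_matI) (auto simp: mat_delete_def B_def C_def D_def four_block_mat_def hess)
  have "det (mat_delete A j n) = det B * det D"
    unfolding blocks
    by (rule det_four_block_mat_lower_left_zero) (auto simp: B_def C_def D_def)
  also have "det D = prod_list (diag_mat D)"
    by (rule det_upper_triangular[of _ "n - j"])
      (auto simp: upper_triangular_def D_def intro!: hess)
  also have "\<dots> = (\<Prod>i = 0..<n - j. A $$ (Suc (i + j), i + j))"
    by (simp add: prod_list_diag_prod D_def)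
  also have "\<dots> = (\<Prod>i = j..<n. A $$ (Suc i, i))"
    using j by (subst prod.atLeastLessThan_shift_0[of _ j]) (simp add: add.commute)
  finally show ?thesis
    by (simp add: B_def)
qed

lemma X_nonzero: "X \<noteq> 0"
  by (simp add: X_def Zero_fract_def eq_fract)

lemma V_nonzero: "V \<noteq> 0"
  by (simp add: V_def Zero_fract_def eq_fract)

lemma one_minus_V_nonzero: "1 - V \<noteq> 0"
  by (simp add: V_def Zero_fract_def One_fract_def eq_fract one_pCons)

text \<open>Setting \<open>v = 0\<close> is not defined on the fraction field, so scaling by
  \<open>1 - V\<close> first clears denominators; both ring homomorphisms then commute with
  \<open>det\<close>.\<close>

lemma det_leading_block_K_nonzero:
  assumes "j < m"
  shows "det (mat j j (\<lambda>p. K_mat m V $$ p)) \<noteq> 0"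
proof
  interpret to_fract: comm_ring_hom "to_fract :: rat poly poly \<Rightarrow> ratfun"
    by unfold_locales simp_all
  \<comment> \<open>The outer variable is \<open>v\<close>, so this evaluation sets
    \<open>v = 0\<close> and keeps \<open>x\<close>.\<close>
  interpret ev: comm_ring_hom "\<lambda>p :: rat poly poly. poly p 0"
    by unfold_locales simp_all
  define x v :: "rat poly poly" where "x = [:[:0, 1:]:]" and "v = [:0, 1:]"
  have XV: "X = to_fract x" "V = to_fract v"
    by (simp_all add: X_def V_def x_def v_def to_fract_def)
  define P where "P = mat j j (\<lambda>(i, k).
    if i = k then (1 - v) * (1 - x * v)
    else if i < k then - ((1 - v) * (x * v))
    else if i = Suc k then x * v
    else 0)"
  assume "det (mat j j (\<lambda>p. K_mat m V $$ p)) = 0"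
  then have "det ((1 - V) \<cdot>\<^sub>m mat j j (\<lambda>p. K_mat m V $$ p)) = 0"
    by simp
  moreover have "(1 - V) \<cdot>\<^sub>m mat j j (\<lambda>p. K_mat m V $$ p) = map_mat to_fract P"
    \<comment> \<open>As \<open>j < m\<close>, the exceptional last diagonal entry lies outside the
      block.\<close>
    using assms one_minus_V_nonzero
    by (intro eq_matI) (auto simp: P_def K_mat_def XV hom_distribs)
  ultimately have "det P = 0"
    by simp
  then have "det (map_mat (\<lambda>p. poly p 0) P) = 0"
    by simp
  moreover have "map_mat (\<lambda>p. poly p 0) P = 1\<^sub>m j"
    by (intro eq_matI) (auto simp: P_def v_def)
  ultimately show False
    by simp
qed

theorem theorem16:
  fixes m :: nat
  assumes "m \<ge> 2"
  shows "\<forall>j<m. adj_mat (K_mat m V) $$ (m - 1, j) \<noteq> 0"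
proof (intro allI impI)
  fix j assume j: "j < m"
  obtain n where m: "m = Suc n"
    using j by (cases m) auto
  have K: "K_mat m V \<in> carrier_mat (Suc n) (Suc n)"
    by (simp add: K_mat_def m)
  have "det (mat_delete (K_mat m V) j n) =
    det (mat j j (\<lambda>p. K_mat m V $$ p)) * (\<Prod>i = j..<n. K_mat m V $$ (Suc i, i))"
    using j by (intro det_mat_delete_last_col_hessenberg[OF K]) (auto simp: K_mat_def m)
  also have "\<dots> = det (mat j j (\<lambda>p. K_mat m V $$ p)) * (\<Prod>i = j..<n. X * V / (1 - V))"
    by (simp add: K_mat_def m)
  also have "\<dots> \<noteq> 0"
    using det_leading_block_K_nonzero[OF j] X_nonzero V_nonzero one_minus_V_nonzero by simp
  \<comment> \<open>The adjugate transposes, so this entry is the cofactor at \<open>(j, n)\<close>,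
    the minor above up to sign.\<close>
  finally show "adj_mat (K_mat m V) $$ (m - 1, j) \<noteq> 0"
    using j K by (simp add: adj_mat_def cofactor_def m)
qed

end
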